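(* Let $\gamma$ be a modulus function and let $\mathcal{L}$ be the family of Lebesgue measurable subsets of $\mathbb{R}$. Then $\tau_\gamma:=\{A\in\mathcal{L}: A\subset\mathcal{D}_\gamma(A)\}$ is a topology on $\mathbb{R}$.
   Context: $|\cdot|$ denotes Lebesgue measure on $\mathbb{R}$ and $A^c=\mathbb{R}\setminus A$. A modulus function is a function $\gamma:[0,\infty)\to[0,\infty)$ such that (i) $\gamma(a)=0\Leftrightarrow a=0$; (ii) $\gamma(a+b)\le\gamma(a)+\gamma(b)$ for all $a,b\ge 0$; (iii) $\gamma$ is right-continuous at $0$; (iv) $\gamma$ is increasing (in the weak sense: $a\le b$ implies $\gamma(a)\le\gamma(b)$). For $A\in\mathcal{L}$, $\mathcal{D}_\gamma(A)$ is the set of $\gamma$-density points of $A$, i.e. of all $x\in\mathbb{R}$ with $\lim_{\alpha\to 0^+}\frac{\gamma(|(x-\alpha,x+\alpha)\cap A^c|)}{\gamma(2\alpha)}=0$. *)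

theory Defs
  imports "HOL-Analysis.Analysis"
begin

text \<open>A modulus function is a map from \<open>[0,\<infinity>)\<close> to \<open>[0,\<infinity>)\<close>; it is represented by a function on the
  reals about whose values at negative arguments nothing is assumed.\<close>

definition modulus_function :: "(real \<Rightarrow> real) \<Rightarrow> bool" where
  "modulus_function \<gamma> \<longleftrightarrow>
     (\<forall>a\<ge>0. \<gamma> a \<ge> 0) \<and>
     (\<forall>a\<ge>0. \<gamma> a = 0 \<longleftrightarrow> a = 0) \<and>
     (\<forall>a\<ge>0. \<forall>b\<ge>0. \<gamma> (a + b) \<le> \<gamma> a + \<gamma> b) \<and>
     continuous (at_right 0) \<gamma> \<and>
     mono_on {0..} \<gamma>"

text \<open>Only meaningful for Lebesgue measurable \<open>A\<close>. The intersection with the bounded interval then has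
  finite measure, so the real-valued \<open>measure\<close> is the Lebesgue measure.\<close>

definition density_points :: "(real \<Rightarrow> real) \<Rightarrow> real set \<Rightarrow> real set" where
  "density_points \<gamma> A =
     {x. ((\<lambda>\<alpha>. \<gamma> (measure lebesgue ({x - \<alpha><..<x + \<alpha>} \<inter> - A)) / \<gamma> (2 * \<alpha>)) \<longlongrightarrow> 0) (at_right 0)}"

definition density_open_sets :: "(real \<Rightarrow> real) \<Rightarrow> real set set" where
  "density_open_sets \<gamma> = {A \<in> sets lebesgue. A \<subseteq> density_points \<gamma> A}"

text \<open>The library predicate \<open>istopology\<close> requires closure under binary intersections and arbitrary
  unions (hence that the empty set is open), but leaves the underlying set unspecified; that it is
  the whole real line has to be stated separately.\<close>

definition topology_on_reals :: "real set set \<Rightarrow> bool" where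
  "topology_on_reals \<T> \<longleftrightarrow> istopology (\<lambda>U. U \<in> \<T>) \<and> UNIV \<in> \<T>"

end

theory Submission
  imports Defs
begin

text \<open>
  Closure under binary intersections is a direct estimate: the complement of \<open>A \<inter> B\<close> in an interval
  is covered by the complements of \<open>A\<close> and of \<open>B\<close>, and \<open>\<gamma>\<close> is increasing and subadditive
  (\<open>density_points_Int\<close>). For unions, enlarging a measurable set only decreases the density
  quotients (\<open>density_points_mono\<close>), so every point of a union of density-open sets is a density
  point of the union, provided that the union is measurable.

  The real content is therefore the measurability of an uncountable union. Two ideas give it.

  First, density with respect to \<open>\<gamma>\<close> implies ordinary Lebesgue density. If a part of measure \<open>m\<close> of an
  interval of length \<open>s\<close> had \<open>s \<le> k * m\<close>, then \<open>\<gamma> s \<le> \<gamma> (k * m) \<le> k * \<gamma> m\<close> by monotonicity and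
  subadditivity; so a quotient \<open>\<gamma> m / \<gamma> s\<close> below \<open>1 / k\<close> forces \<open>m / s\<close> below \<open>1 / k\<close>
  (\<open>modulus_ratio_less_imp_less\<close>).

  Second, a set \<open>U\<close> is Lebesgue measurable as soon as each of its points has arbitrarily small balls
  that are filled, up to an arbitrarily small proportion, by a measurable subset of \<open>U\<close> which may
  depend on the ball (\<open>lebesgue_measurable_if_measurably_dense\<close>). Inside an open set \<open>G\<close> of
  finite measure, the Vitali covering theorem selects countably many disjoint balls of this kind that
  cover \<open>U \<inter> G\<close> up to a null set. The filling subsets of the selected balls form a countable, hence
  measurable, union inside \<open>U\<close>, and what it misses has outer measure at most \<open>e\<close> times the measure
  of \<open>G\<close>. Letting \<open>e\<close> tend to \<open>0\<close> and exhausting the space by balls shows that \<open>U\<close> is measurable.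
\<close>

section \<open>Measurability from density at small scales\<close>

text \<open>Disjointness turns the proportional bounds on the single balls into one bound by the measure of
  \<open>G\<close>, however many balls there are: summed over finitely many of them, the measures of the balls
  amount to at most that of \<open>G\<close>.\<close>

lemma measure_UN_ball_defects_le:
  fixes a :: "'i \<Rightarrow> 'a::euclidean_space"
  assumes "countable C" and sub: "\<And>i. i \<in> C \<Longrightarrow> ball (a i) (r i) \<subseteq> G"
    and G: "G \<in> lmeasurable" and "0 \<le> e"
    and disj: "pairwise (\<lambda>i j. disjnt (ball (a i) (r i)) (ball (a j) (r j))) C"
    and meas: "\<And>i. i \<in> C \<Longrightarrow> A i \<in> sets lebesgue"
    and small: "\<And>i. i \<in> C \<Longrightarrow>
      measure lebesgue (ball (a i) (r i) - A i) \<le> e * measure lebesgue (ball (a i) (r i))"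
  shows "(\<Union>i\<in>C. ball (a i) (r i) - A i) \<in> lmeasurable"
    and "measure lebesgue (\<Union>i\<in>C. ball (a i) (r i) - A i) \<le> e * measure lebesgue G"
proof -
  have defect: "ball (a i) (r i) - A i \<in> lmeasurable" if "i \<in> C" for i
    using meas [OF that] by (intro fmeasurable_Diff lmeasurable_ball)
  have fin: "measure lebesgue (\<Union>i\<in>I. ball (a i) (r i) - A i) \<le> e * measure lebesgue G"
    if I: "I \<subseteq> C" "finite I" for I
  proof -
    have "measure lebesgue (\<Union>i\<in>I. ball (a i) (r i) - A i)
        \<le> (\<Sum>i\<in>I. measure lebesgue (ball (a i) (r i) - A i))"
      using I by (intro measure_UNION_le fmeasurableD defect) auto
    also have "\<dots> \<le> (\<Sum>i\<in>I. e * measure lebesgue (ball (a i) (r i)))"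
      using I small by (intro sum_mono) auto
    also have "\<dots> = e * (\<Sum>i\<in>I. measure lebesgue (ball (a i) (r i)))"
      by (simp add: sum_distrib_left)
    also have "(\<Sum>i\<in>I. measure lebesgue (ball (a i) (r i)))
        = measure lebesgue (\<Union>i\<in>I. ball (a i) (r i))"
      using I disj by (intro measure_UNION' [symmetric]) (auto intro: pairwise_mono)
    also have "e * \<dots> \<le> e * measure lebesgue G"
      using I sub G \<open>0 \<le> e\<close>
      by (intro mult_left_mono measure_mono_fmeasurable) auto
    finally show ?thesis .
  qed
  show "(\<Union>i\<in>C. ball (a i) (r i) - A i) \<in> lmeasurable"
    using fin by (intro fmeasurable_UN_bound [OF \<open>countable C\<close> defect])
  show "measure lebesgue (\<Union>i\<in>C. ball (a i) (r i) - A i) \<le> e * measure lebesgue G"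
    using fin by (intro measure_UN_bound [OF \<open>countable C\<close> defect])
qed

text \<open>Density is tested through measurable subsets of \<open>U\<close>, so that the notion makes sense before \<open>U\<close>
  is known to be measurable. Only some arbitrarily small balls have to be nearly filled, because
  a Vitali cover requires no more, and \<open>A\<close> may change with the ball.\<close>

definition measurably_dense_at :: "'a::euclidean_space set \<Rightarrow> 'a \<Rightarrow> bool" where
  "measurably_dense_at U x \<longleftrightarrow>
     (\<forall>e>0. \<forall>d>0. \<exists>r A. 0 < r \<and> r < d \<and> A \<subseteq> U \<and> A \<in> sets lebesgue \<and>
        measure lebesgue (ball x r - A) \<le> e * measure lebesgue (ball x r))"

text \<open>The balls inside \<open>G\<close> that are filled by a measurable subset of \<open>U\<close> up to the proportion \<open>e\<close> form a
  Vitali cover of \<open>U \<inter> G\<close>. For a disjoint countable selection, \<open>B\<close> collects the filled parts, while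
  \<open>T\<close> collects the unfilled parts and the null set left uncovered.\<close>

lemma ex_measurable_inner_approximation:
  fixes U :: "'a::euclidean_space set"
  assumes dense: "\<And>x. x \<in> U \<Longrightarrow> measurably_dense_at U x"
    and G: "open G" "G \<in> lmeasurable" and "0 < e"
  obtains B T where "B \<in> sets lebesgue" "B \<subseteq> U \<inter> G" "U \<inter> G - B \<subseteq> T"
    "T \<in> lmeasurable" "measure lebesgue T \<le> e * measure lebesgue G"
proof -
  define filled where "filled x r A \<longleftrightarrow> A \<subseteq> U \<and> A \<in> sets lebesgue \<and>
        measure lebesgue (ball x r - A) \<le> e * measure lebesgue (ball x r)" for x r A
  define K where "K = {(x, r). ball x r \<subseteq> G \<and> (\<exists>A. filled x r A)}"
  have "\<exists>i. i \<in> K \<and> x \<in> ball (fst i) (snd i) \<and> snd i < d"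
    if x: "x \<in> U \<inter> G" and "0 < d" for x d
  proof -
    obtain k where "0 < k" and k: "ball x k \<subseteq> G"
      using x \<open>open G\<close> openE by blast
    then obtain r A where r: "0 < r" "r < min d k" and A: "filled x r A"
      using x dense [of x] \<open>0 < d\<close> \<open>0 < e\<close>
      unfolding measurably_dense_at_def filled_def by (metis IntD1 min_less_iff_conj)
    have "ball x r \<subseteq> G"
      using r k by (meson min_less_iff_conj less_imp_le order_trans subset_ball)
    then show ?thesis
      using r A by (intro exI [of _ "(x, r)"]) (auto simp: K_def)
  qed
  then obtain C where C: "countable C" "C \<subseteq> K"
      and disj: "pairwise (\<lambda>i j. disjnt (ball (fst i) (snd i)) (ball (fst j) (snd j))) C"
      and negl: "negligible (U \<inter> G - (\<Union>i\<in>C. ball (fst i) (snd i)))"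
    by (rule Vitali_covering_theorem_balls [of "U \<inter> G" K fst snd])
  have "\<forall>i\<in>C. \<exists>A. filled (fst i) (snd i) A"
    using C by (auto simp: K_def)
  then obtain A where A: "\<And>i. i \<in> C \<Longrightarrow> filled (fst i) (snd i) (A i)"
    by metis
  define N where "N = U \<inter> G - (\<Union>i\<in>C. ball (fst i) (snd i))"
  define D where "D = (\<Union>i\<in>C. ball (fst i) (snd i) - A i)"
  define B where "B = (\<Union>i\<in>C. ball (fst i) (snd i) \<inter> A i)"
  have inG: "ball (fst i) (snd i) \<subseteq> G" if "i \<in> C" for i
    using C(2) that unfolding K_def by force
  have D: "D \<in> lmeasurable" "measure lebesgue D \<le> e * measure lebesgue G"
    using A unfolding D_def filled_def
    by (blast intro: measure_UN_ball_defects_le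
        [OF C(1) inG G(2) less_imp_le [OF \<open>0 < e\<close>] disj])+
  have N: "N \<in> lmeasurable" "measure lebesgue N = 0"
    using negl by (auto simp: N_def negligible_iff_measure)
  show thesis
  proof
    show "B \<in> sets lebesgue"
      using C A by (auto simp: B_def filled_def intro!: sets.countable_UN')
    show "B \<subseteq> U \<inter> G"
      using A inG by (fastforce simp: B_def filled_def)
    show "U \<inter> G - B \<subseteq> N \<union> D"
      by (auto simp: N_def B_def D_def)
    show "N \<union> D \<in> lmeasurable"
      using N D by blast
    show "measure lebesgue (N \<union> D) \<le> e * measure lebesgue G"
      using measure_Un_le [of N lebesgue D] N D by (simp add: fmeasurableD)
  qed
qed

lemma lebesgue_measurable_Int_if_measurably_dense:
  fixes U :: "'a::euclidean_space set"
  assumes dense: "\<And>x. x \<in> U \<Longrightarrow> measurably_dense_at U x"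
    and G: "open G" "G \<in> lmeasurable"
  shows "U \<inter> G \<in> sets lebesgue"
proof -
  have "\<exists>B T. B \<in> sets lebesgue \<and> B \<subseteq> U \<inter> G \<and> U \<inter> G - B \<subseteq> T \<and>
      T \<in> lmeasurable \<and> measure lebesgue T \<le> inverse (real (Suc n)) * measure lebesgue G" for n
    by (rule ex_measurable_inner_approximation [OF dense G, of "inverse (real (Suc n))"]) auto
  then obtain B T where B: "\<And>n. B n \<in> sets lebesgue" "\<And>n. B n \<subseteq> U \<inter> G"
    and T: "\<And>n. U \<inter> G - B n \<subseteq> T n" "\<And>n. T n \<in> lmeasurable"
      "\<And>n::nat. measure lebesgue (T n) \<le> inverse (real (Suc n)) * measure lebesgue G"
    by metis
  have "negligible (U \<inter> G - (\<Union>n. B n))"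
    unfolding negligible_outer
  proof (intro allI impI)
    fix e :: real
    assume "0 < e"
    have "(\<lambda>n. inverse (real (Suc n)) * measure lebesgue G) \<longlonglongrightarrow> 0 * measure lebesgue G"
      by (intro tendsto_intros LIMSEQ_inverse_real_of_nat)
    then have "\<forall>\<^sub>F n in sequentially. inverse (real (Suc n)) * measure lebesgue G < e"
      using \<open>0 < e\<close> by (intro order_tendstoD(2)) simp_all
    then obtain n where "inverse (real (Suc n)) * measure lebesgue G < e"
      using eventually_happens' [OF sequentially_bot] by blast
    then show "\<exists>S. U \<inter> G - (\<Union>n. B n) \<subseteq> S \<and> S \<in> lmeasurable \<and> measure lebesgue S < e"
      using T [of n] by (intro exI [of _ "T n"]) auto
  qed
  then have "(\<Union>n. B n) \<union> (U \<inter> G - (\<Union>n. B n)) \<in> sets lebesgue"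
    using B(1) by (intro sets.Un sets.countable_UN negligible_imp_sets) auto
  moreover have "(\<Union>n. B n) \<union> (U \<inter> G - (\<Union>n. B n)) = U \<inter> G"
    using B(2) by blast
  ultimately show ?thesis
    by simp
qed

lemma lebesgue_measurable_if_measurably_dense:
  fixes U :: "'a::euclidean_space set"
  assumes "\<And>x. x \<in> U \<Longrightarrow> measurably_dense_at U x"
  shows "U \<in> sets lebesgue"
proof -
  have "U = (\<Union>n. U \<inter> ball 0 (real n))"
    using reals_Archimedean2 by (auto simp: dist_norm)
  also have "\<dots> \<in> sets lebesgue"
    using lebesgue_measurable_Int_if_measurably_dense [OF assms open_ball lmeasurable_ball]
    by (intro sets.countable_UN) blast
  finally show ?thesis .
qed

section \<open>Density with respect to a modulus\<close>

lemma modulus_pos: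
  assumes "modulus_function \<gamma>" "0 < a"
  shows "0 < \<gamma> a"
proof -
  have "0 \<le> \<gamma> a" "\<gamma> a \<noteq> 0"
    using assms by (auto simp: modulus_function_def)
  then show ?thesis
    by simp
qed

lemma modulus_nonneg:
  assumes "modulus_function \<gamma>" "0 \<le> a"
  shows "0 \<le> \<gamma> a"
  using assms by (simp add: modulus_function_def)

lemma modulus_mono:
  assumes "modulus_function \<gamma>" "0 \<le> a" "a \<le> b"
  shows "\<gamma> a \<le> \<gamma> b"
proof -
  have "mono_on {0..} \<gamma>"
    using assms(1) by (simp add: modulus_function_def)
  then show ?thesis
    by (rule mono_onD) (use assms(2,3) in simp_all)
qed

lemma modulus_add_le:
  assumes "modulus_function \<gamma>" "0 \<le> a" "0 \<le> b"
  shows "\<gamma> (a + b) \<le> \<gamma> a + \<gamma> b"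
  using assms by (simp add: modulus_function_def)

lemma modulus_zero:
  assumes "modulus_function \<gamma>"
  shows "\<gamma> 0 = 0"
  using assms by (simp add: modulus_function_def)

lemma modulus_of_nat_mult_le:
  assumes "modulus_function \<gamma>" "0 \<le> a"
  shows "\<gamma> (real k * a) \<le> real k * \<gamma> a"
proof (induction k)
  case 0
  then show ?case using modulus_zero [OF assms(1)] by simp
next
  case (Suc k)
  have "\<gamma> (real (Suc k) * a) = \<gamma> (a + real k * a)"
    by (simp add: algebra_simps)
  also have "\<dots> \<le> \<gamma> a + \<gamma> (real k * a)"
    using assms(2) by (intro modulus_add_le [OF assms(1)]) simp_all
  finally show ?case
    using Suc by (simp add: algebra_simps)
qed

text \<open>This is the link from \<open>\<gamma>\<close> back to Lebesgue measure: \<open>k\<close> copies of \<open>m\<close> cannot reach \<open>s\<close>, since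
  otherwise \<open>\<gamma> s\<close> would be at most \<open>k * \<gamma> m\<close>.\<close>

lemma modulus_ratio_less_imp_less:
  assumes \<gamma>: "modulus_function \<gamma>" and "0 \<le> m" "0 < s" "0 < k"
    and ratio: "\<gamma> m / \<gamma> s < 1 / real k"
  shows "real k * m < s"
proof (rule ccontr)
  assume "\<not> real k * m < s"
  then have "\<gamma> s \<le> \<gamma> (real k * m)"
    using \<open>0 < s\<close> by (intro modulus_mono [OF \<gamma>]) simp_all
  also have "\<dots> \<le> real k * \<gamma> m"
    by (rule modulus_of_nat_mult_le [OF \<gamma> \<open>0 \<le> m\<close>])
  finally have "1 / real k \<le> \<gamma> m / \<gamma> s"
    using \<open>0 < k\<close> modulus_pos [OF \<gamma> \<open>0 < s\<close>]
    by (simp add: pos_le_divide_eq pos_divide_le_eq mult.commute)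
  then show False
    using ratio by simp
qed

text \<open>A \<open>\<gamma>\<close>-density point is a Lebesgue density point: the relative defect falls below
  \<open>1 / k\<close> once the \<open>\<gamma>\<close>-quotient does.\<close>

lemma density_point_imp_small_relative_defect:
  assumes \<gamma>: "modulus_function \<gamma>" and x: "x \<in> density_points \<gamma> A" and "0 < e"
  shows "\<forall>\<^sub>F r in at_right 0.
    measure lebesgue (ball x r - A) \<le> e * measure lebesgue (ball x r)"
proof -
  obtain k where k: "0 < k" "inverse (real k) < e"
    using reals_Archimedean [OF \<open>0 < e\<close>] by blast
  let ?m = "\<lambda>r. measure lebesgue ({x - r<..<x + r} \<inter> - A)"
  have "\<forall>\<^sub>F r in at_right 0. \<gamma> (?m r) / \<gamma> (2 * r) < 1 / real k"
    using x k unfolding density_points_def by (intro order_tendstoD(2)) auto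
  then show ?thesis
    using eventually_at_right_less
  proof eventually_elim
    case (elim r)
    have "real k * ?m r < 2 * r"
      using elim k by (intro modulus_ratio_less_imp_less [OF \<gamma>]) auto
    then have "?m r \<le> inverse (real k) * (2 * r)"
      using k by (simp add: field_simps)
    also have "\<dots> \<le> e * (2 * r)"
      using k elim by (intro mult_right_mono) auto
    finally show ?case
      using elim by (simp add: ball_eq_greaterThanLessThan Diff_eq)
  qed
qed

lemma density_pointI:
  assumes \<gamma>: "modulus_function \<gamma>" 
    and bound: "\<And>\<alpha>. 0 < \<alpha> \<Longrightarrow> 
       \<gamma> (measure lebesgue ({x - \<alpha><..<x + \<alpha>} \<inter> - A)) / \<gamma> (2 * \<alpha>) \<le> h \<alpha>"
    and h: "(h \<longlongrightarrow> 0) (at_right 0)"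
  shows "x \<in> density_points \<gamma> A"
proof -
  let ?f = "\<lambda>\<alpha>. \<gamma> (measure lebesgue ({x - \<alpha><..<x + \<alpha>} \<inter> - A)) / \<gamma> (2 * \<alpha>)"
  have "0 \<le> ?f \<alpha>" if "0 < \<alpha>" for \<alpha>
    using that by (intro divide_nonneg_nonneg modulus_nonneg [OF \<gamma>]) simp_all
  then have "\<forall>\<^sub>F \<alpha> in at_right 0. 0 \<le> ?f \<alpha>"
    by (simp add: eventually_at_filter)
  moreover have "\<forall>\<^sub>F \<alpha> in at_right 0. ?f \<alpha> \<le> h \<alpha>"
    using bound by (simp add: eventually_at_filter)
  ultimately have "(?f \<longlongrightarrow> 0) (at_right 0)"
    by (rule tendsto_sandwich [OF _ _ tendsto_const h])
  then show ?thesis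
    by (simp add: density_points_def)
qed

lemma lmeasurable_interval_minus:
  fixes a b :: real
  assumes "A \<in> sets lebesgue"
  shows "{a<..<b} \<inter> - A \<in> lmeasurable"
proof (rule fmeasurable_Int_fmeasurable)
  show "{a<..<b} \<in> lmeasurable"
    by (simp add: lmeasurable_open)
  show "- A \<in> sets lebesgue"
    using sets.compl_sets [OF assms] by (simp add: Compl_eq_Diff_UNIV)
qed

lemma density_points_Int:
  assumes \<gamma>: "modulus_function \<gamma>" and A: "A \<in> sets lebesgue" and B: "B \<in> sets lebesgue"
    and x: "x \<in> density_points \<gamma> A" "x \<in> density_points \<gamma> B"
  shows "x \<in> density_points \<gamma> (A \<inter> B)"
proof (rule density_pointI [OF \<gamma>])
  let ?m = "\<lambda>A \<alpha>. measure lebesgue ({x - \<alpha><..<x + \<alpha>} \<inter> - A)"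
  show "((\<lambda>\<alpha>. \<gamma> (?m A \<alpha>) / \<gamma> (2 * \<alpha>) + \<gamma> (?m B \<alpha>) / \<gamma> (2 * \<alpha>)) \<longlongrightarrow> 0) (at_right 0)"
    using x by (intro tendsto_add_zero) (simp_all add: density_points_def)
  fix \<alpha> :: real
  assume "0 < \<alpha>"
  have "{x - \<alpha><..<x + \<alpha>} \<inter> - (A \<inter> B)
      = ({x - \<alpha><..<x + \<alpha>} \<inter> - A) \<union> ({x - \<alpha><..<x + \<alpha>} \<inter> - B)"
    by blast
  then have "?m (A \<inter> B) \<alpha> \<le> ?m A \<alpha> + ?m B \<alpha>"
    using measure_Un_le [OF fmeasurableD fmeasurableD,
        OF lmeasurable_interval_minus [OF A] lmeasurable_interval_minus [OF B]]
    by simp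
  then have "\<gamma> (?m (A \<inter> B) \<alpha>) \<le> \<gamma> (?m A \<alpha> + ?m B \<alpha>)"
    by (intro modulus_mono [OF \<gamma>]) auto
  also have "\<dots> \<le> \<gamma> (?m A \<alpha>) + \<gamma> (?m B \<alpha>)"
    by (rule modulus_add_le [OF \<gamma> measure_nonneg measure_nonneg])
  finally show "\<gamma> (?m (A \<inter> B) \<alpha>) / \<gamma> (2 * \<alpha>)
      \<le> \<gamma> (?m A \<alpha>) / \<gamma> (2 * \<alpha>) + \<gamma> (?m B \<alpha>) / \<gamma> (2 * \<alpha>)"
    unfolding add_divide_distrib [symmetric]
    by (rule divide_right_mono) (use modulus_nonneg [OF \<gamma>, of "2 * \<alpha>"] \<open>0 < \<alpha>\<close> in simp)
qed

lemma density_points_mono: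
  assumes \<gamma>: "modulus_function \<gamma>" and A: "A \<in> sets lebesgue" and B: "B \<in> sets lebesgue"
    and "A \<subseteq> B"
  shows "density_points \<gamma> A \<subseteq> density_points \<gamma> B"
proof
  fix x
  assume x: "x \<in> density_points \<gamma> A"
  let ?m = "\<lambda>A \<alpha>. measure lebesgue ({x - \<alpha><..<x + \<alpha>} \<inter> - A)"
  show "x \<in> density_points \<gamma> B"
  proof (rule density_pointI [OF \<gamma>])
    show "((\<lambda>\<alpha>. \<gamma> (?m A \<alpha>) / \<gamma> (2 * \<alpha>)) \<longlongrightarrow> 0) (at_right 0)"
      using x unfolding density_points_def by blast
    fix \<alpha> :: real
    assume "0 < \<alpha>"
    have "?m B \<alpha> \<le> ?m A \<alpha>"
      using \<open>A \<subseteq> B\<close> lmeasurable_interval_minus [OF A] lmeasurable_interval_minus [OF B]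
      by (intro measure_mono_fmeasurable) (auto simp: fmeasurableD)
    then have "\<gamma> (?m B \<alpha>) \<le> \<gamma> (?m A \<alpha>)"
      by (intro modulus_mono [OF \<gamma>]) auto
    then show "\<gamma> (?m B \<alpha>) / \<gamma> (2 * \<alpha>) \<le> \<gamma> (?m A \<alpha>) / \<gamma> (2 * \<alpha>)"
      by (rule divide_right_mono) (use modulus_nonneg [OF \<gamma>, of "2 * \<alpha>"] \<open>0 < \<alpha>\<close> in simp)
  qed
qed

section \<open>The topology of density-open sets\<close>

lemma density_open_sets_Union_measurable:
  assumes \<gamma>: "modulus_function \<gamma>" and \<U>: "\<U> \<subseteq> density_open_sets \<gamma>"
  shows "\<Union>\<U> \<in> sets lebesgue"
proof (rule lebesgue_measurable_if_measurably_dense)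
  fix x
  assume "x \<in> \<Union>\<U>"
  then obtain A where A: "A \<in> \<U>" "x \<in> A"
    by blast
  then have "A \<in> sets lebesgue" and x: "x \<in> density_points \<gamma> A"
    using \<U> unfolding density_open_sets_def by auto
  show "measurably_dense_at (\<Union>\<U>) x"
    unfolding measurably_dense_at_def
  proof (intro allI impI)
    fix e d :: real
    assume "0 < e" "0 < d"
    have "\<forall>\<^sub>F r in at_right 0. 0 < r \<and> r < d \<and>
        measure lebesgue (ball x r - A) \<le> e * measure lebesgue (ball x r)"
      using density_point_imp_small_relative_defect [OF \<gamma> x \<open>0 < e\<close>]
        eventually_at_right_less eventually_at_right_real [OF \<open>0 < d\<close>]
      by eventually_elim auto
    then obtain r where "0 < r" "r < d"
        "measure lebesgue (ball x r - A) \<le> e * measure lebesgue (ball x r)"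
      using eventually_happens' [OF trivial_limit_at_right_real] by blast
    then show "\<exists>r A. 0 < r \<and> r < d \<and> A \<subseteq> \<Union>\<U> \<and> A \<in> sets lebesgue \<and>
        measure lebesgue (ball x r - A) \<le> e * measure lebesgue (ball x r)"
      using A \<open>A \<in> sets lebesgue\<close> by blast
  qed
qed

theorem theorem7:
  fixes \<gamma> :: "real \<Rightarrow> real"
  assumes "modulus_function \<gamma>"
  shows "topology_on_reals (density_open_sets \<gamma>)"
proof -
  have Int: "A \<inter> B \<in> density_open_sets \<gamma>"
    if A: "A \<in> density_open_sets \<gamma>" and B: "B \<in> density_open_sets \<gamma>" for A B
  proof -
    have meas: "A \<in> sets lebesgue" "B \<in> sets lebesgue"
      using A B by (simp_all add: density_open_sets_def)
    have "x \<in> density_points \<gamma> (A \<inter> B)" if "x \<in> A \<inter> B" for x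
      using that A B
      by (intro density_points_Int [OF assms meas]) (auto simp: density_open_sets_def)
    then show ?thesis
      using sets.Int [OF meas] by (simp add: density_open_sets_def subset_iff)
  qed
  have Union: "\<Union>\<U> \<in> density_open_sets \<gamma>" if \<U>: "\<U> \<subseteq> density_open_sets \<gamma>" for \<U>
  proof -
    note meas = density_open_sets_Union_measurable [OF assms \<U>]
    have "A \<subseteq> density_points \<gamma> (\<Union>\<U>)" if "A \<in> \<U>" for A
    proof -
      have A: "A \<in> sets lebesgue" "A \<subseteq> density_points \<gamma> A"
        using that \<U> by (auto simp: density_open_sets_def)
      show ?thesis
        using A(2) density_points_mono [OF assms A(1) meas Union_upper [OF that]]
        by (rule order_trans)
    qed
    then have "\<Union>\<U> \<subseteq> density_points \<gamma> (\<Union>\<U>)"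
      by (rule Union_least)
    then show ?thesis
      using meas by (simp add: density_open_sets_def)
  qed
  have UNIV: "UNIV \<in> density_open_sets \<gamma>"
    by (simp add: density_open_sets_def density_points_def modulus_zero [OF assms])
  show ?thesis
    unfolding topology_on_reals_def istopology_def
    using Int Union UNIV by (simp add: subset_iff)
qed

end
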